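(* Let $V$ be a locally convex space with its natural uniformity $\mu$, let $G\le\mathrm{Aut}(V)$ be an equicontinuous subgroup, and let $X\subset V$ be a bounded, $(\text{weak},\mu)$-fragmented, $G$-invariant subset. Then every (not necessarily closed) quasiminimal $G$-subspace $Y$ of $X$ (e.g., every orbit) is a Kadec subset of $V$.
   Context: $\mathrm{Aut}(V)$ is the group of topological linear automorphisms of $V$; the natural uniformity $\mu$ is the additive uniformity of $V$ (generating its original, "strong", topology). $X$ is $(\text{weak},\mu)$-fragmented if for every nonempty $A\subset X$ and every $\varepsilon\in\mu$ there is a weakly open subset $O$ of $X$ such that $O\cap A\neq\emptyset$ and $O\cap A$ is $\varepsilon$-small (i.e. $(O\cap A)\times(O\cap A)\subset\varepsilon$). $X$ is regarded as a $G$-flow with its weak topology. A $G$-invariant subset $Y\subset X$ is a quasiminimal $G$-subspace if, in the relative weak topology of $Y$, for every $y\in Y$ the closure of $Gy$ in $Y$ has nonempty interior in $Y$. A subset of $V$ is a Kadec (or light) subset if the weak topology and the original topology of $V$ coincide on it. *)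

theory Defs
  imports "HOL-Analysis.Analysis" "HOL-Algebra.Group"
begin

text \<open>Real locally convex spaces. The Hausdorff axiom is not part of the definition, so
  results for this class cover the separated spaces as a special case.\<close>

class locally_convex_space = real_vector + topological_ab_group_add +
  assumes tendsto_scaleR_nhds:
      "((\<lambda>(c, x). c *\<^sub>R x) \<longlongrightarrow> r *\<^sub>R a) (nhds r \<times>\<^sub>F nhds a)"
    and convex_nhds_base_raw:
      "open U \<Longrightarrow> 0 \<in> U \<Longrightarrow>
        \<exists>C. open C \<and>
          (\<forall>x\<in>C. \<forall>y\<in>C. \<forall>u\<ge>0. \<forall>v\<ge>0. u + v = 1 \<longrightarrow> u *\<^sub>R x + v *\<^sub>R y \<in> C) \<and>
          0 \<in> C \<and> C \<subseteq> U"

text \<open>The constant \<open>convex\<close> cannot occur in the class specification, where its sort constraint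
  is rejected; its definition is unfolded there.\<close>

lemma convex_nhds_base:
  fixes U :: "'a::locally_convex_space set"
  assumes "open U" "0 \<in> U"
  shows "\<exists>C. open C \<and> convex C \<and> 0 \<in> C \<and> C \<subseteq> U"
  unfolding convex_def by (rule convex_nhds_base_raw[OF assms])

instance real_normed_vector \<subseteq> locally_convex_space
proof
  fix r :: real and a :: 'a
  show "((\<lambda>(c, x). c *\<^sub>R x) \<longlongrightarrow> r *\<^sub>R a) (nhds r \<times>\<^sub>F nhds a)"
    unfolding case_prod_unfold by (intro tendsto_scaleR filterlim_fst filterlim_snd)
next
  fix U :: "'a set"
  assume "open U" "0 \<in> U"
  then obtain e where "e > 0" "ball 0 e \<subseteq> U"
    using open_contains_ball by blast
  then show "\<exists>C. open C \<and>
      (\<forall>x\<in>C. \<forall>y\<in>C. \<forall>u\<ge>0. \<forall>v\<ge>0. u + v = 1 \<longrightarrow> u *\<^sub>R x + v *\<^sub>R y \<in> C) \<and> 0 \<in> C \<and> C \<subseteq> U"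
    using convex_ball[of "0::'a" e] unfolding convex_def
    by (intro exI[of _ "ball 0 e"]) auto
qed

text \<open>The entourages of the additive uniformity are the sets \<open>\<epsilon>\<close> with
  \<open>eventually (\<lambda>p. p \<in> \<epsilon>) additive_uniformity\<close>, that is, those containing
  \<open>{(x, y). x - y \<in> U}\<close> for some neighbourhood \<open>U\<close> of \<open>0\<close>.\<close>

definition additive_uniformity :: "('a::topological_ab_group_add \<times> 'a) filter" where
  "additive_uniformity = filtercomap (\<lambda>(x, y). x - y) (nhds 0)"

definition weak_topology :: "'a::locally_convex_space topology" where
  "weak_topology = topology_generated_by
     {f -` S | (f :: 'a \<Rightarrow> real) S. linear f \<and> continuous_on UNIV f \<and> open S}"

text \<open>Boundedness in the sense of von Neumann; \<open>bounded\<close> of the library is metric.\<close>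

definition vn_bounded :: "'a::locally_convex_space set \<Rightarrow> bool" where
  "vn_bounded X \<longleftrightarrow>
     (\<forall>U. open U \<and> 0 \<in> U \<longrightarrow> (\<exists>r>0. \<forall>t\<ge>r. X \<subseteq> (\<lambda>u. t *\<^sub>R u) ` U))"

definition Aut_lcs :: "('a::locally_convex_space \<Rightarrow> 'a) monoid" where
  "Aut_lcs = \<lparr>carrier = {f. linear f \<and> bij f \<and> continuous_on UNIV f \<and> continuous_on UNIV (inv_into UNIV f)},
              mult = (\<circ>), one = id\<rparr>"

lemma group_Aut_lcs: "group (Aut_lcs :: ('a::locally_convex_space \<Rightarrow> 'a) monoid)"
proof (rule groupI)
  fix f g :: "'a \<Rightarrow> 'a"
  assume "f \<in> carrier Aut_lcs" "g \<in> carrier Aut_lcs"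
  then show "f \<otimes>\<^bsub>Aut_lcs\<^esub> g \<in> carrier Aut_lcs"
    by (auto simp: Aut_lcs_def o_inv_distrib intro!: linear_compose bij_comp)
      (auto simp: comp_def intro: continuous_on_compose2[OF _ _ subset_UNIV])
next
  fix f :: "'a \<Rightarrow> 'a"
  assume f: "f \<in> carrier Aut_lcs"
  then have "linear (inv_into UNIV f)"
    by (auto simp: Aut_lcs_def linear_iff bij_def surj_f_inv_f intro!: inv_f_eq)
  with f have "inv_into UNIV f \<in> carrier Aut_lcs"
    by (simp add: Aut_lcs_def bij_imp_bij_inv inv_inv_eq)
  moreover from f have "inv_into UNIV f \<circ> f = id"
    by (simp add: Aut_lcs_def bij_def)
  ultimately show "\<exists>g\<in>carrier Aut_lcs. g \<otimes>\<^bsub>Aut_lcs\<^esub> f = \<one>\<^bsub>Aut_lcs\<^esub>"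
    by (auto simp: Aut_lcs_def)
qed (auto simp: Aut_lcs_def linear_id o_assoc)

definition equicontinuous :: "('a::locally_convex_space \<Rightarrow> 'a) set \<Rightarrow> bool" where
  "equicontinuous F \<longleftrightarrow>
     (\<forall>x \<epsilon>. eventually (\<lambda>p. p \<in> \<epsilon>) additive_uniformity \<longrightarrow>
        eventually (\<lambda>y. \<forall>f\<in>F. (f x, f y) \<in> \<epsilon>) (nhds x))"

text \<open>\<open>fragmented T \<mu> X\<close>: the subset \<open>X\<close> of the space \<open>T\<close> is \<open>(T, \<mu>)\<close>-fragmented.\<close>

definition fragmented :: "'a topology \<Rightarrow> ('a \<times> 'a) filter \<Rightarrow> 'a set \<Rightarrow> bool" where
  "fragmented T \<mu> X \<longleftrightarrow>
     (\<forall>A \<epsilon>. A \<subseteq> X \<and> A \<noteq> {} \<and> eventually (\<lambda>p. p \<in> \<epsilon>) \<mu> \<longrightarrow>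
        (\<exists>W. openin (subtopology T X) W \<and> W \<inter> A \<noteq> {} \<and> (W \<inter> A) \<times> (W \<inter> A) \<subseteq> \<epsilon>))"

definition invariant_under :: "('a \<Rightarrow> 'a) set \<Rightarrow> 'a set \<Rightarrow> bool" where
  "invariant_under G Y \<longleftrightarrow> (\<forall>g\<in>G. \<forall>y\<in>Y. g y \<in> Y)"

definition orbit_of :: "('a \<Rightarrow> 'a) set \<Rightarrow> 'a \<Rightarrow> 'a set" where
  "orbit_of G x = (\<lambda>g. g x) ` G"

definition quasiminimal_subspace ::
    "'a topology \<Rightarrow> ('a \<Rightarrow> 'a) set \<Rightarrow> 'a set \<Rightarrow> 'a set \<Rightarrow> bool" where
  "quasiminimal_subspace T G X Y \<longleftrightarrow>
     Y \<subseteq> X \<and> invariant_under G Y \<and>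
     (\<forall>y\<in>Y. subtopology T Y interior_of (subtopology T Y closure_of orbit_of G y) \<noteq> {})"

definition Kadec :: "'a::locally_convex_space set \<Rightarrow> bool" where
  "Kadec Y \<longleftrightarrow> subtopology weak_topology Y = subtopology euclidean Y"

end

theory Submission
  imports Defs
begin

text \<open>Let \<open>y\<close> be a point of \<open>Y\<close>. The weak closure of \<open>G y\<close> in \<open>Y\<close> contains a nonempty relatively
  weakly open set; by fragmentability it can be shrunk to one that is as small as we please, and it
  still contains some \<open>g y\<close> because \<open>G y\<close> is dense in it. Pulling it back by \<open>g\<close> gives a weak
  neighbourhood of \<open>y\<close> in \<open>Y\<close>, which is small because \<open>G\<close> is equicontinuous.\<close>

lemma topspace_weak_topology [simp]: "topspace weak_topology = UNIV"
proof -
  have "UNIV \<in> {f -` S | (f :: 'a \<Rightarrow> real) S. linear f \<and> continuous_on UNIV f \<and> open S}"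
    by (intro CollectI exI[of _ "\<lambda>_. 0"] exI[of _ UNIV]) (simp add: linear_zero)
  then show ?thesis
    unfolding weak_topology_def topology_generated_by_topspace by blast
qed

lemma openin_weak_topology_vimage:
  fixes f :: "'a::locally_convex_space \<Rightarrow> real"
  assumes "linear f" "continuous_on UNIV f" "open S"
  shows "openin weak_topology (f -` S)"
  using assms unfolding weak_topology_def by (intro topology_generated_by_Basis) blast

text \<open>Subbasic weakly open sets are preimages of open sets under continuous functionals, so
  the weak topology is the coarser one.\<close>

lemma openin_weak_topology_imp_open:
  assumes "openin weak_topology S"
  shows "open S"
proof -
  have "generate_topology_on {f -` S | (f :: 'a \<Rightarrow> real) S. linear f \<and> continuous_on UNIV f \<and> open S} S"
    using assms unfolding weak_topology_def openin_topology_generated_by_iff .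
  then show ?thesis
    by induction (auto intro: open_vimage)
qed

text \<open>Precomposition with \<open>g\<close> turns continuous functionals into continuous
  functionals, so preimages of subbasic sets are subbasic. Hence \<open>G\<close> acts by weakly
  continuous maps.\<close>

lemma openin_weak_topology_linear_vimage:
  fixes g :: "'a::locally_convex_space \<Rightarrow> 'b::locally_convex_space"
  assumes g: "linear g" "continuous_on UNIV g" and "openin weak_topology S"
  shows "openin weak_topology (g -` S)"
proof -
  have "generate_topology_on {f -` S | (f :: 'b \<Rightarrow> real) S. linear f \<and> continuous_on UNIV f \<and> open S} S"
    using assms(3) unfolding weak_topology_def openin_topology_generated_by_iff .
  then show ?thesis
  proof induction
    case (Int A B)
    then show ?case by (simp add: vimage_Int openin_Int)
  next
    case (UN K)
    then show ?case by (auto simp: vimage_Union)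
  next
    case (Basis A)
    then obtain f :: "'b \<Rightarrow> real" and S where f: "A = f -` S" "linear f" "continuous_on UNIV f" "open S"
      by blast
    have "continuous_on UNIV (f \<circ> g)"
      using continuous_on_compose2[OF f(3) g(2)] by (simp add: comp_def)
    then have "openin weak_topology ((f \<circ> g) -` S)"
      using f g by (intro openin_weak_topology_vimage linear_compose)
    then show ?case
      by (simp add: f vimage_comp)
  qed simp
qed

lemma carrier_Aut_lcsD:
  assumes "g \<in> carrier Aut_lcs"
  shows "linear g" "continuous_on UNIV g"
  using assms by (auto simp: Aut_lcs_def)

lemma subgroup_Aut_lcs_left_inverse:
  assumes "subgroup G Aut_lcs" "g \<in> G"
  obtains h where "h \<in> G" "\<And>x. h (g x) = x"
proof
  show "inv\<^bsub>Aut_lcs\<^esub> g \<in> G"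
    using assms by (rule subgroup.m_inv_closed)
  have "inv\<^bsub>Aut_lcs\<^esub> g \<otimes>\<^bsub>Aut_lcs\<^esub> g = \<one>\<^bsub>Aut_lcs\<^esub>"
    using assms by (intro group.l_inv group_Aut_lcs) (rule subgroup.mem_carrier)
  then show "(inv\<^bsub>Aut_lcs\<^esub> g) (g x) = x" for x
    by (auto simp: Aut_lcs_def fun_eq_iff)
qed

lemma subgroup_Aut_lcs_comp:
  assumes "subgroup G Aut_lcs" "g \<in> G" "h \<in> G"
  shows "g \<circ> h \<in> G"
  using subgroup.m_closed[OF assms] by (simp add: Aut_lcs_def)

lemma subgroup_Aut_lcs_id:
  assumes "subgroup G Aut_lcs"
  shows "id \<in> G"
  using subgroup.one_closed[OF assms] by (simp add: Aut_lcs_def)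

lemma orbit_of_refl:
  assumes "subgroup G Aut_lcs"
  shows "x \<in> orbit_of G x"
  using subgroup_Aut_lcs_id[OF assms] unfolding orbit_of_def by (metis id_apply image_eqI)

text \<open>Right multiplication by \<open>g\<close> and by its inverse \<open>h\<close>
  reparametrizes each orbit as the other.\<close>

lemma orbit_of_eq:
  assumes G: "subgroup G Aut_lcs" and "y \<in> orbit_of G x"
  shows "orbit_of G y = orbit_of G x"
proof -
  obtain g where g: "g \<in> G" "y = g x"
    using assms(2) by (auto simp: orbit_of_def)
  obtain h where h: "h \<in> G" "\<And>z. h (g z) = z"
    using subgroup_Aut_lcs_left_inverse[OF G g(1)] by metis
  show ?thesis
  proof (rule Set.set_eqI)
    fix z
    have "z \<in> orbit_of G x" if "k \<in> G" "z = k y" for k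
      using that g(2) subgroup_Aut_lcs_comp[OF G that(1) g(1)]
      unfolding orbit_of_def by (intro image_eqI[of _ _ "k \<circ> g"]) auto
    moreover have "z \<in> orbit_of G y" if "k \<in> G" "z = k x" for k
      using that g(2) h(2) subgroup_Aut_lcs_comp[OF G that(1) h(1)]
      unfolding orbit_of_def by (intro image_eqI[of _ _ "k \<circ> h"]) auto
    ultimately show "z \<in> orbit_of G y \<longleftrightarrow> z \<in> orbit_of G x"
      unfolding orbit_of_def by auto
  qed
qed

text \<open>Inside an orbit, the orbit of any point is the whole space, so its closure and the
  interior of that closure are everything.\<close>

lemma quasiminimal_subspace_orbit_of:
  assumes G: "subgroup G Aut_lcs" and X: "invariant_under G X" "x \<in> X"
    and T: "topspace T = UNIV"
  shows "quasiminimal_subspace T G X (orbit_of G x)"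
  unfolding quasiminimal_subspace_def
proof (intro conjI ballI)
  show "orbit_of G x \<subseteq> X"
    using X by (auto simp: orbit_of_def invariant_under_def)
  show "invariant_under G (orbit_of G x)"
    unfolding invariant_under_def
  proof (intro ballI)
    fix g y
    assume "g \<in> G" "y \<in> orbit_of G x"
    then have "g y \<in> orbit_of G y"
      by (simp add: orbit_of_def)
    then show "g y \<in> orbit_of G x"
      using orbit_of_eq[OF G \<open>y \<in> orbit_of G x\<close>] by simp
  qed
  fix y
  assume "y \<in> orbit_of G x"
  then have "orbit_of G y = topspace (subtopology T (orbit_of G x))"
    by (simp add: orbit_of_eq[OF G] T)
  then have "subtopology T (orbit_of G x) interior_of
      (subtopology T (orbit_of G x) closure_of orbit_of G y) = orbit_of G y"
    by (metis closure_of_topspace interior_of_topspace)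
  then show "subtopology T (orbit_of G x) interior_of
      (subtopology T (orbit_of G x) closure_of orbit_of G y) \<noteq> {}"
    using orbit_of_refl[OF G, of y] by auto
qed

lemma eventually_additive_uniformityI:
  assumes "eventually (\<lambda>u. u \<in> U) (nhds 0)"
  shows "eventually (\<lambda>p. p \<in> {(x, y). x - y \<in> U}) additive_uniformity"
  using assms unfolding additive_uniformity_def eventually_filtercomap by auto

lemma quasiminimal_subspace_small_nhd:
  fixes Y :: "'a::locally_convex_space set"
  assumes G: "subgroup G Aut_lcs" and equi: "equicontinuous G"
    and frag: "fragmented weak_topology additive_uniformity X"
    and quasi: "quasiminimal_subspace weak_topology G X Y"
    and y: "y \<in> Y" "open T" "y \<in> T"
  obtains W where "openin weak_topology W" "y \<in> W" "W \<inter> Y \<subseteq> T"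
proof -
  let ?TY = "subtopology weak_topology Y"
  have YX: "Y \<subseteq> X" and inv: "\<And>g z. g \<in> G \<Longrightarrow> z \<in> Y \<Longrightarrow> g z \<in> Y"
    and int: "?TY interior_of (?TY closure_of orbit_of G y) \<noteq> {}"
    using quasi y by (auto simp: quasiminimal_subspace_def invariant_under_def)
  have "((\<lambda>u. y - u) \<longlongrightarrow> y - 0) (nhds 0)"
    by (intro tendsto_intros filterlim_ident)
  \<comment> \<open>The sign is chosen for the differences \<open>f 0 - f v\<close> below: as
    \<open>f 0 = 0\<close> for linear \<open>f\<close>, the condition on \<open>v\<close> will read
    \<open>y + f v \<in> T\<close>.\<close>
  then have "eventually (\<lambda>u. u \<in> {u. y - u \<in> T}) (nhds 0)"
    using y by (auto dest: topological_tendstoD)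
  \<comment> \<open>Equicontinuity at \<open>0\<close> suffices: by linearity it controls
    \<open>f a - f b\<close> for all \<open>f\<close> in \<open>G\<close> as soon as
    \<open>a - b\<close> is close to \<open>0\<close>.\<close>
  with equi have "eventually (\<lambda>v. \<forall>f\<in>G. (f 0, f v) \<in> {(a, b). a - b \<in> {u. y - u \<in> T}}) (nhds 0)"
    unfolding equicontinuous_def by (blast dest: eventually_additive_uniformityI)
  then have V: "eventually (\<lambda>v. v \<in> {v. \<forall>f\<in>G. y - (f 0 - f v) \<in> T}) (nhds 0)"
    by simp
  define V where "V = {v. \<forall>f\<in>G. y - (f 0 - f v) \<in> T}"
  \<comment> \<open>Fragmentability is applied to this interior and not to \<open>Y\<close>, so that
    the small piece found is relatively open in \<open>Y\<close> and \<open>orbit_of G y\<close> is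
    dense in it.\<close>
  define A where "A = ?TY interior_of (?TY closure_of orbit_of G y)"
  have A: "openin ?TY A" "A \<subseteq> Y" "A \<noteq> {}" "A \<subseteq> ?TY closure_of orbit_of G y"
    using int interior_of_subset_topspace[of ?TY] unfolding A_def
    by (auto intro: interior_of_subset[THEN subsetD])
  have "eventually (\<lambda>p. p \<in> {(x, y). x - y \<in> V}) additive_uniformity"
    using V unfolding V_def by (rule eventually_additive_uniformityI)
  moreover have "A \<subseteq> X"
    using A(2) YX by (rule order_trans)
  ultimately obtain W where W: "openin (subtopology weak_topology X) W" "W \<inter> A \<noteq> {}"
      "(W \<inter> A) \<times> (W \<inter> A) \<subseteq> {(x, y). x - y \<in> V}"
    using frag A(3) unfolding fragmented_def by meson
  \<comment> \<open>\<open>W\<close> is open relative to \<open>X\<close> and \<open>A\<close>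
    relative to \<open>Y\<close>; since \<open>Y \<subseteq> X\<close>, their intersection is open
    relative to \<open>Y\<close>.\<close>
  have "openin ?TY (W \<inter> A)"
  proof -
    from W(1) obtain W' where W': "openin weak_topology W'" "W = W' \<inter> X"
      by (auto simp: openin_subtopology)
    from A(1) obtain A' where A': "openin weak_topology A'" "A = A' \<inter> Y"
      by (auto simp: openin_subtopology)
    have "W \<inter> A = (W' \<inter> A') \<inter> Y"
      using W' A' YX by auto
    then show ?thesis
      using W' A' by (auto simp: openin_subtopology)
  qed
  \<comment> \<open>Passing to a weakly open set of the whole space allows the pullback by
    \<open>g\<close>, which is weakly continuous there.\<close>
  then obtain O' where O': "openin weak_topology O'" "W \<inter> A = O' \<inter> Y"
    by (auto simp: openin_subtopology)
  obtain g where g: "g \<in> G" "g y \<in> W \<inter> A"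
  proof -
    obtain a where a: "a \<in> W \<inter> A"
      using W(2) by blast
    with A(4) have "a \<in> ?TY closure_of orbit_of G y"
      by blast
    with a \<open>openin ?TY (W \<inter> A)\<close> obtain z where "z \<in> orbit_of G y" "z \<in> W \<inter> A"
      unfolding in_closure_of by blast
    then show thesis
      using that by (auto simp: orbit_of_def)
  qed
  obtain h where h: "h \<in> G" "\<And>x. h (g x) = x"
    using subgroup_Aut_lcs_left_inverse[OF G g(1)] by metis
  have lin: "linear g" "linear h" and cont: "continuous_on UNIV g"
    using carrier_Aut_lcsD subgroup.mem_carrier[OF G] g(1) h(1) by blast+
  show thesis
  proof
    show "openin weak_topology (g -` O')"
      using lin(1) cont O'(1) by (rule openin_weak_topology_linear_vimage)
    show "y \<in> g -` O'"
      using g(2) O'(2) by auto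
    show "g -` O' \<inter> Y \<subseteq> T"
    proof
      fix z
      assume "z \<in> g -` O' \<inter> Y"
      then have "g z \<in> W \<inter> A"
        using O'(2) inv[OF g(1)] by auto
      then have "g z - g y \<in> V"
        using W(3) g(2) by auto
      then have "y - (h 0 - h (g z - g y)) \<in> T"
        using h(1) by (auto simp: V_def)
      \<comment> \<open>By linearity and \<open>h (g x) = x\<close>, the point
        \<open>y - (h 0 - h (g z - g y))\<close> equals \<open>y + (z - y) = z\<close>.\<close>
      then show "z \<in> T"
        using lin by (simp add: linear_0 linear_diff h(2))
    qed
  qed
qed

text \<open>The weak topology is always coarser, so only the other inclusion needs the hypothesis,
  and openness is checked point by point.\<close>

lemma KadecI:
  assumes "\<And>y T. y \<in> Y \<Longrightarrow> open T \<Longrightarrow> y \<in> T \<Longrightarrow>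
    \<exists>W. openin weak_topology W \<and> y \<in> W \<and> W \<inter> Y \<subseteq> T"
  shows "Kadec Y"
  unfolding Kadec_def topology_eq
proof (intro allI iffI)
  fix S
  assume "openin (subtopology weak_topology Y) S"
  then show "openin (top_of_set Y) S"
    using openin_weak_topology_imp_open by (auto simp: openin_subtopology)
next
  fix S
  assume "openin (top_of_set Y) S"
  then obtain T where T: "open T" "S = T \<inter> Y"
    by (auto simp: openin_subtopology)
  show "openin (subtopology weak_topology Y) S"
  proof (subst openin_subopen, intro ballI)
    fix y
    assume "y \<in> S"
    then obtain W where "openin weak_topology W" "y \<in> W" "W \<inter> Y \<subseteq> T"
      using assms T by blast
    then show "\<exists>U. openin (subtopology weak_topology Y) U \<and> y \<in> U \<and> U \<subseteq> S"
      using \<open>y \<in> S\<close> T by (intro exI[of _ "W \<inter> Y"]) (auto simp: openin_subtopology)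
  qed
qed

theorem theorem8p1:
  fixes G :: "('a::locally_convex_space \<Rightarrow> 'a) set" and X :: "'a set"
  assumes "subgroup G Aut_lcs"
    and "equicontinuous G"
    and "vn_bounded X"
    and "fragmented weak_topology additive_uniformity X"
    and "invariant_under G X"
  shows "(\<forall>Y. quasiminimal_subspace weak_topology G X Y \<longrightarrow> Kadec Y) \<and>
         (\<forall>x\<in>X. quasiminimal_subspace weak_topology G X (orbit_of G x))"
proof (intro conjI allI impI ballI)
  fix Y
  assume Y: "quasiminimal_subspace weak_topology G X Y"
  show "Kadec Y"
  proof (rule KadecI)
    fix y T
    assume "y \<in> Y" "open T" "y \<in> T"
    with Y obtain W where "openin weak_topology W" "y \<in> W" "W \<inter> Y \<subseteq> T"
      by (rule quasiminimal_subspace_small_nhd[OF assms(1,2,4)])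
    then show "\<exists>W. openin weak_topology W \<and> y \<in> W \<and> W \<inter> Y \<subseteq> T"
      by blast
  qed
next
  fix x
  assume "x \<in> X"
  with assms show "quasiminimal_subspace weak_topology G X (orbit_of G x)"
    by (intro quasiminimal_subspace_orbit_of) auto
qed

end
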